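(* Let $f\in\mathbb{Z}[x]\setminus\mathbb{Z}$ and let $g\in\mathbb{Z}[x]$ be nonzero. Set $d=\deg(f)$ and $e=\deg(g)$, and let $f_d$ be the leading coefficient of $f$. Then, for every $\alpha\in\mathbb{N}$, $$f_d^{\,e+1-(\alpha+1)(d-1)}\;\mathrm{Res}\begin{bmatrix}g\,\mathrm{d}x\\ f^{\alpha+1}\end{bmatrix}\in\mathbb{Z}$$ and $$\log\Big|f_d^{\,e+1-(\alpha+1)(d-1)}\;\mathrm{Res}\begin{bmatrix}g\,\mathrm{d}x\\ f^{\alpha+1}\end{bmatrix}\Big|\le \mathrm{h}_1(g)+(e+1-(\alpha+1)d)\,\mathrm{h}(f)+(e-d+1)\log(2).$$ If $e<(\alpha+1)d-1$, then $\mathrm{Res}\begin{bmatrix}g\,\mathrm{d}x\\ f^{\alpha+1}\end{bmatrix}=0$.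
   Context: $\mathbb{N}=\{0,1,2,\dots\}$ and $\log 0=-\infty$. For $f=\sum_i f_ix^i\in\mathbb{Z}[x]\setminus\{0\}$, the height is $\mathrm{h}(f)=\log\max_i|f_i|$ and the length is $\mathrm{h}_1(f)=\log\sum_i|f_i|$. $\mathrm{Res}\begin{bmatrix}g\,\mathrm{d}x\\ f^{\alpha+1}\end{bmatrix}$ denotes the global residue on the affine line $\mathbb{A}^1_{\mathbb{C}}$: the sum, over all complex roots $\xi$ of $f$, of the residue at $\xi$ of the rational $1$-form $\frac{g}{f^{\alpha+1}}\mathrm{d}x$. *)

theory Defs
  imports "HOL-Complex_Analysis.Complex_Analysis"
begin

text \<open>Logarithm of a nonnegative real with the convention \<open>log 0 = -\<infinity>\<close>
  (the library has \<open>ln 0 = 0\<close> on the reals).\<close>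

definition elog :: "real \<Rightarrow> ereal" where
  "elog x = (if x = 0 then -\<infinity> else ereal (ln x))"

text \<open>The height and the length of an integer polynomial are meaningful for nonzero
  polynomials only; there the arguments of \<open>ln\<close> are at least 1.\<close>

definition poly_height :: "int poly \<Rightarrow> real" where
  "poly_height f = ln (real_of_int (Max ((\<lambda>i. \<bar>coeff f i\<bar>) ` {..degree f})))"

definition poly_length :: "int poly \<Rightarrow> real" where
  "poly_length f = ln (real_of_int (\<Sum>i\<le>degree f. \<bar>coeff f i\<bar>))"

text \<open>\<open>global_residue g f n\<close> is the global residue of the form \<open>g dx / f^n\<close> on the complex
  affine line; the sum is over distinct roots, and is finite for nonzero \<open>f\<close>.\<close>

definition global_residue :: "int poly \<Rightarrow> int poly \<Rightarrow> nat \<Rightarrow> complex" where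
  "global_residue g f n =
    (\<Sum>\<xi> | poly (map_poly of_int f) \<xi> = 0.
       residue (\<lambda>z. poly (map_poly of_int g) z / poly (map_poly of_int f) z ^ n) \<xi>)"

end

theory Submission
  imports Defs
begin

text \<open>
  Write \<open>n = \<alpha> + 1\<close> and \<open>Q = f ^ n\<close>. The residues of a rational form on the affine line add up to
  minus its residue at infinity, so the global residue of \<open>x^j dx / Q\<close> is the coefficient of
  \<open>x^(-1)\<close> in the expansion of \<open>x^j / Q\<close> in powers of \<open>1/x\<close>. With \<open>F\<close> the reversed polynomial of
  \<open>f\<close>, that is the coefficient of \<open>y^(j+1-nd)\<close> in the power series \<open>(1/F)^n\<close>, and \<open>0\<close> if
  \<open>j + 1 < n d\<close> (lemma \<open>residue_sum_monom_eq_fps_nth\<close>). By linearity in \<open>g\<close> the theorem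
  becomes a statement on the coefficients of \<open>(1/F)^n\<close>.

  The coefficients \<open>a_m\<close> of \<open>1/F\<close> obey the recursion
  \<open>f_d a_m = [m = 0] - (\<Sum>i=1..min d m. f_(d-i) a_(m-i))\<close>. It yields by induction that
  \<open>f_d^(m+1) a_m\<close> is an integer, whence \<open>f_d^(n+m)\<close> clears the denominator of the \<open>m\<close>-th
  coefficient of \<open>(1/F)^n\<close>.

  For the size, let \<open>H\<close> be the largest absolute value of a coefficient of \<open>f\<close>, let
  \<open>L = \<bar>f_d\<bar>\<close>, and weight the coefficients by \<open>v_m = \<bar>a_m\<bar> / r^m\<close> with \<open>r = 2H/L\<close>. Then
  \<open>v_m \<le> [m = 0]/L + (\<Sum>i=1..min d m. v_(m-i) / 2^i)\<close>. The weights \<open>1/2^i\<close> add up to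
  \<open>1 - 1/2^d\<close>. As this is at most \<open>1\<close>, each \<open>v_m\<close> is at most \<open>1/L\<close>; as it falls short of \<open>1\<close> by
  \<open>1/2^d\<close>, the sum of all \<open>v_m\<close> is at most \<open>2^d / L\<close>. In the convolution that computes
  \<open>(1/F)^(\<alpha>+1)\<close> the sum bound applies to \<open>\<alpha>\<close> factors and the pointwise bound to the last one,
  which gives \<open>2^(\<alpha>d) r^m / L^n\<close> for the \<open>m\<close>-th coefficient. With \<open>m = e + 1 - nd\<close> the power
  of \<open>2\<close> is \<open>\<alpha>d + m = e - d + 1\<close>. Bounding each factor by its sum would instead lose a
  factor \<open>2^d\<close>. A monomial \<open>x^j\<close> of \<open>g\<close> with \<open>j < e\<close> leaves a surplus factor \<open>L^(e-j)\<close>, which is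
  at most the factor \<open>(2H)^(e-j)\<close> by which its own bound is smaller than that of \<open>x^e\<close>.
\<close>

section \<open>Global residues as coefficients of a power series\<close>

text \<open>
  The residue theorem on a large circle turns the sum into the integral of \<open>h\<close>, which differs
  little from that of \<open>c / z\<close>: the difference is \<open>o(1/\<bar>z\<bar>)\<close>, and the circle has length
  \<open>2 \<pi> \<bar>z\<bar>\<close>.
\<close>
lemma sum_residues_eq_limit_at_infinity:
  fixes h :: "complex \<Rightarrow> complex"
  assumes fin: "finite S" and holo: "h holomorphic_on - S"
    and lim: "((\<lambda>z. z * h z) \<longlongrightarrow> c) at_infinity"
  shows "(\<Sum>\<xi>\<in>S. residue h \<xi>) = c"
proof -
  define R where "R = (\<Sum>\<xi>\<in>S. residue h \<xi>)"
  have "norm (R - c) \<le> \<epsilon>" if "\<epsilon> > 0" for \<epsilon> :: real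
  proof -
    from lim obtain b where b: "\<And>z. norm z \<ge> b \<Longrightarrow> dist (z * h z) c < \<epsilon>"
      using \<open>\<epsilon> > 0\<close> unfolding tendsto_iff eventually_at_infinity by blast
    obtain B where B: "\<And>\<xi>. \<xi> \<in> S \<Longrightarrow> norm \<xi> \<le> B"
      using finite_imp_bounded[OF fin] unfolding bounded_iff by blast
    define r where "r = max b (max B 0) + 1"
    have r: "r > 0" "r \<ge> b" "r > B" by (auto simp: r_def)
    have off: "sphere 0 r \<subseteq> - S" using B r(3) by force
    have "contour_integral (circlepath 0 r) h =
          2 * of_real pi * \<i> * (\<Sum>\<xi>\<in>S. winding_number (circlepath 0 r) \<xi> * residue h \<xi>)"
      using Residue_theorem[of UNIV S h "circlepath 0 r"] fin holo off r
      by (simp add: Compl_eq_Diff_UNIV connected_UNIV)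
    also have "(\<Sum>\<xi>\<in>S. winding_number (circlepath 0 r) \<xi> * residue h \<xi>) = R"
      unfolding R_def
    proof (rule sum.cong)
      fix \<xi> assume "\<xi> \<in> S"
      hence "norm (\<xi> - 0) < r" using B r(3) by fastforce
      thus "winding_number (circlepath 0 r) \<xi> * residue h \<xi> = residue h \<xi>"
        by (simp add: winding_number_circlepath)
    qed simp
    finally have int: "contour_integral (circlepath 0 r) h = 2 * of_real pi * \<i> * R" .
    have "h contour_integrable_on circlepath 0 r"
      by (rule contour_integrable_holomorphic_simple[of _ "- S"])
         (use fin holo off r in \<open>auto simp: finite_imp_closed open_Compl\<close>)
    hence "(h has_contour_integral 2 * of_real pi * \<i> * R) (circlepath 0 r)"
      using int has_contour_integral_integral by metis
    moreover have "((\<lambda>z. c / (z - 0)) has_contour_integral 2 * of_real pi * \<i> * c) (circlepath 0 r)"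
      using Cauchy_integral_circlepath_simple[of "\<lambda>_. c" 0 r 0] r by simp
    ultimately have diff: "((\<lambda>z. h z - c / (z - 0)) has_contour_integral
        2 * of_real pi * \<i> * R - 2 * of_real pi * \<i> * c) (circlepath 0 r)"
      by (rule has_contour_integral_diff)
    have "norm (2 * of_real pi * \<i> * R - 2 * of_real pi * \<i> * c) \<le> \<epsilon> / r * (2 * pi * r)"
    proof (rule has_contour_integral_bound_circlepath[OF diff])
      fix z :: complex assume "norm (z - 0) = r"
      hence z: "norm z = r" "z \<noteq> 0" using r by auto
      have "h z - c / (z - 0) = (z * h z - c) / z" using z by (simp add: field_simps)
      hence "norm (h z - c / (z - 0)) = dist (z * h z) c / r"
        by (simp add: norm_divide z dist_norm)
      also have "\<dots> \<le> \<epsilon> / r"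
        using b[of z] z r by (intro divide_right_mono) auto
      finally show "norm (h z - c / (z - 0)) \<le> \<epsilon> / r" .
    qed (use r \<open>\<epsilon> > 0\<close> in auto)
    also have "2 * of_real pi * \<i> * R - 2 * of_real pi * \<i> * c = 2 * of_real pi * \<i> * (R - c)"
      by (simp add: algebra_simps)
    finally show ?thesis using r by (simp add: norm_mult)
  qed
  hence "norm (R - c) \<le> 0" by (rule field_le_epsilon[of _ 0, simplified])
  thus ?thesis by (simp add: R_def)
qed

definition residue_sum :: "complex poly \<Rightarrow> complex poly \<Rightarrow> complex" where
  "residue_sum Q P = (\<Sum>\<xi> | poly Q \<xi> = 0. residue (\<lambda>z. poly P z / poly Q z) \<xi>)"

lemma holomorphic_on_poly_quotient:
  assumes "\<And>z. z \<in> S \<Longrightarrow> poly Q z \<noteq> 0"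
  shows "(\<lambda>z. poly P z / poly Q z :: complex) holomorphic_on S"
  using assms by (auto intro!: holomorphic_intros)

text \<open>
  Residues are linear among functions that are holomorphic on a common punctured open set; around
  a root of \<open>Q\<close> this is the plane without the other roots.
\<close>
lemma open_minus_other_roots:
  assumes "Q \<noteq> (0 :: complex poly)"
  shows "open (- ({z. poly Q z = 0} - {\<xi>}))"
  using poly_roots_finite[OF assms] by (intro open_Compl finite_imp_closed) auto

lemma residue_sum_add:
  assumes "Q \<noteq> 0"
  shows "residue_sum Q (P1 + P2) = residue_sum Q P1 + residue_sum Q P2"
  unfolding residue_sum_def sum.distrib[symmetric]
proof (rule sum.cong)
  fix \<xi> assume "\<xi> \<in> {\<xi>. poly Q \<xi> = 0}"
  have "residue (\<lambda>z. poly P1 z / poly Q z + poly P2 z / poly Q z) \<xi> =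
        residue (\<lambda>z. poly P1 z / poly Q z) \<xi> + residue (\<lambda>z. poly P2 z / poly Q z) \<xi>"
    by (rule residue_add[OF open_minus_other_roots[OF assms]])
       (auto intro: holomorphic_on_poly_quotient)
  thus "residue (\<lambda>z. poly (P1 + P2) z / poly Q z) \<xi> =
        residue (\<lambda>z. poly P1 z / poly Q z) \<xi> + residue (\<lambda>z. poly P2 z / poly Q z) \<xi>"
    by (simp add: add_divide_distrib)
qed simp

lemma residue_sum_smult:
  assumes "Q \<noteq> 0"
  shows "residue_sum Q (smult a P) = a * residue_sum Q P"
  unfolding residue_sum_def sum_distrib_left
proof (rule sum.cong)
  fix \<xi> assume "\<xi> \<in> {\<xi>. poly Q \<xi> = 0}"
  have "residue (\<lambda>z. a * (poly P z / poly Q z)) \<xi> = a * residue (\<lambda>z. poly P z / poly Q z) \<xi>"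
    by (rule residue_lmul[OF open_minus_other_roots[OF assms]])
       (auto intro: holomorphic_on_poly_quotient)
  thus "residue (\<lambda>z. poly (smult a P) z / poly Q z) \<xi> = a * residue (\<lambda>z. poly P z / poly Q z) \<xi>"
    by simp
qed simp

lemma residue_sum_0 [simp]: "residue_sum Q 0 = 0"
  by (simp add: residue_sum_def residue_const)

lemma residue_sum_sum:
  assumes "Q \<noteq> 0"
  shows "residue_sum Q (\<Sum>i\<in>A. P i) = (\<Sum>i\<in>A. residue_sum Q (P i))"
  by (induction A rule: infinite_finite_induct) (auto simp: residue_sum_add[OF assms])

text \<open>The form extends to the polynomial form \<open>P dx\<close>, which has no poles.\<close>
lemma residue_sum_mult_denominator:
  assumes "Q \<noteq> 0"
  shows "residue_sum Q (P * Q) = 0"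
  unfolding residue_sum_def
proof (intro sum.neutral ballI)
  fix \<xi> :: complex
  have "eventually (\<lambda>z. z \<in> - ({z. poly Q z = 0} - {\<xi>})) (at \<xi>)"
    by (rule eventually_at_in_open'[OF open_minus_other_roots[OF assms]]) auto
  hence "eventually (\<lambda>z. poly (P * Q) z / poly Q z = poly P z) (at \<xi>)"
    using eventually_neq_at_within[of \<xi>] by eventually_elim auto
  hence "residue (\<lambda>z. poly (P * Q) z / poly Q z) \<xi> = residue (poly P) \<xi>"
    by (rule residue_cong) simp
  also have "\<dots> = 0"
    by (rule residue_holo[of UNIV]) (auto intro: holomorphic_intros)
  finally show "residue (\<lambda>z. poly (P * Q) z / poly Q z) \<xi> = 0" .
qed

lemma residue_sum_eq_limit:
  assumes "Q \<noteq> 0" and "((\<lambda>z. z * poly P z / poly Q z) \<longlongrightarrow> c) at_infinity"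
  shows "residue_sum Q P = c"
  unfolding residue_sum_def
  by (rule sum_residues_eq_limit_at_infinity)
     (use assms poly_roots_finite in \<open>auto intro: holomorphic_on_poly_quotient\<close>)

lemma monomial_times_over_poly:
  "(\<lambda>z. z * poly (monom 1 j) z / poly Q z) =
   (\<lambda>z. poly (monom 1 (Suc j)) z / poly Q z :: complex)"
  by (simp add: poly_monom)

lemma residue_sum_monom_below:
  assumes "Suc j < degree Q"
  shows "residue_sum Q (monom 1 j) = 0"
  using assms
  by (intro residue_sum_eq_limit, force, unfold monomial_times_over_poly,
      intro poly_divide_tendsto_0_at_infinity) (auto simp: degree_monom_eq)

lemma residue_sum_monom_top:
  assumes "Suc j = degree Q"
  shows "residue_sum Q (monom 1 j) = 1 / lead_coeff Q"
proof (rule residue_sum_eq_limit)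
  show "Q \<noteq> 0" using assms by auto
  have "((\<lambda>z. inverse (poly Q z / z ^ degree Q)) \<longlongrightarrow> inverse (lead_coeff Q)) at_infinity"
    using assms by (intro tendsto_inverse poly_divide_tendsto_aux) auto
  hence "((\<lambda>z. poly (monom 1 (Suc j)) z / poly Q z) \<longlongrightarrow> 1 / lead_coeff Q) at_infinity"
    by (simp add: poly_monom assms inverse_eq_divide)
  thus "((\<lambda>z. z * poly (monom 1 j) z / poly Q z) \<longlongrightarrow> 1 / lead_coeff Q) at_infinity"
    by (simp only: monomial_times_over_poly)
qed

text \<open>
  Since \<open>x^i Q / Q\<close> has no residues, the residues of \<open>x^j / Q\<close> satisfy the linear recurrence
  with the coefficients of \<open>Q\<close>. For the generating series this says that its product with
  the reversed \<open>Q\<close> vanishes beyond degree \<open>N - 1\<close>, where \<open>N\<close> is the degree of \<open>Q\<close>; the behaviour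
  of \<open>x^j / Q\<close> at infinity for \<open>j < N\<close> determines the rest of the product, which is
  \<open>fps_X ^ (N - 1)\<close>.
\<close>
lemma residue_sum_monom_eq_fps_nth:
  assumes deg: "degree Q > 0"
  shows "residue_sum Q (monom 1 j) =
    (if Suc j < degree Q then 0
     else inverse (fps_of_poly (reflect_poly Q)) $ (Suc j - degree Q))"
proof -
  define N where "N = degree Q"
  define T where "T = fps_of_poly (reflect_poly Q)"
  define R where "R = Abs_fps (\<lambda>j. residue_sum Q (monom 1 j))"
  have Q: "Q \<noteq> 0" using deg by auto
  have T0: "T $ 0 \<noteq> 0" using Q by (simp add: T_def)
  have T_nth: "T $ i = (if i > N then 0 else coeff Q (N - i))" for i
    by (simp add: T_def coeff_reflect_poly N_def)
  have "T * R = fps_X ^ (N - 1)"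
  proof (rule fps_ext)
    fix k
    have nth: "(T * R) $ k = (\<Sum>i\<le>k. T $ i * residue_sum Q (monom 1 (k - i)))"
      by (simp add: fps_mult_nth R_def atMost_atLeast0)
    show "(T * R) $ k = (fps_X ^ (N - 1)) $ k"
    proof (cases "k < N")
      case True
      have "(T * R) $ k = (\<Sum>i\<le>k. if i = 0 then T $ 0 * residue_sum Q (monom 1 k) else 0)"
        unfolding nth
        by (rule sum.cong) (use True in \<open>auto intro!: residue_sum_monom_below simp: N_def\<close>)
      also have "\<dots> = T $ 0 * residue_sum Q (monom 1 k)" by (simp add: sum.delta)
      also have "\<dots> = (if k = N - 1 then 1 else 0)"
      proof (cases "k = N - 1")
        case True
        thus ?thesis using Q deg by (subst residue_sum_monom_top) (auto simp: N_def T_nth)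
      next
        case False
        thus ?thesis using \<open>k < N\<close> by (subst residue_sum_monom_below) (auto simp: N_def)
      qed
      finally show ?thesis by simp
    next
      case False
      have "(T * R) $ k = (\<Sum>i\<le>N. T $ i * residue_sum Q (monom 1 (k - i)))"
        unfolding nth by (rule sum.mono_neutral_right) (use False in \<open>auto simp: T_nth\<close>)
      also have "\<dots> = (\<Sum>i\<le>N. residue_sum Q (smult (coeff Q i) (monom 1 (k - N + i))))"
        by (rule sum.reindex_bij_witness[of _ "\<lambda>i. N - i" "\<lambda>i. N - i"])
           (use False in \<open>auto simp: T_nth residue_sum_smult[OF Q]\<close>)
      also have "\<dots> = residue_sum Q (\<Sum>i\<le>N. smult (coeff Q i) (monom 1 (k - N + i)))"
        by (simp add: residue_sum_sum[OF Q])
      also have "(\<Sum>i\<le>N. smult (coeff Q i) (monom 1 (k - N + i))) =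
                 monom 1 (k - N) * (\<Sum>i\<le>N. monom (coeff Q i) i)"
        by (simp add: sum_distrib_left mult_monom smult_monom)
      also have "(\<Sum>i\<le>N. monom (coeff Q i) i) = Q"
        by (simp add: N_def poly_as_sum_of_monoms)
      also have "residue_sum Q (monom 1 (k - N) * Q) = 0"
        by (rule residue_sum_mult_denominator[OF Q])
      finally show ?thesis using False deg by (auto simp: N_def)
    qed
  qed
  hence "inverse T * T * R = inverse T * fps_X ^ (N - 1)" by (simp add: mult.assoc)
  hence "R = fps_X ^ (N - 1) * inverse T"
    by (simp only: inverse_mult_eq_1[OF T0] mult_1) (simp only: mult.commute)
  hence "R $ j = (fps_X ^ (N - 1) * inverse T) $ j" by simp
  thus ?thesis using deg unfolding fps_X_power_mult_nth
    by (auto simp: R_def T_def N_def Suc_diff_le split: if_splits)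
qed

section \<open>Coefficients of powers of a power series\<close>

text \<open>
  The series \<open>c * A(c y)\<close> has coefficients in the integers, hence so has its \<open>n\<close>-th power
  \<open>c^n * A^n(c y)\<close>.
\<close>
lemma fps_power_nth_scaled_Ints:
  fixes A :: "'a :: comm_ring_1 fps"
  assumes "\<And>m. c ^ Suc m * A $ m \<in> \<int>"
  shows "c ^ (n + m) * (A ^ n) $ m \<in> \<int>"
proof (induction n arbitrary: m)
  case 0
  show ?case by (cases "m = 0") auto
next
  case (Suc n)
  have "c ^ (Suc n + m) * (A ^ Suc n) $ m =
        (\<Sum>i=0..m. (c ^ Suc i * A $ i) * (c ^ (n + (m - i)) * (A ^ n) $ (m - i)))"
    unfolding power_Suc[of A] fps_mult_nth sum_distrib_left
  proof (rule sum.cong)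
    fix i assume "i \<in> {0..m}"
    hence "Suc n + m = Suc i + (n + (m - i))" by auto
    hence "c ^ (Suc n + m) = c ^ Suc i * c ^ (n + (m - i))" by (simp only: power_add)
    thus "c ^ (Suc n + m) * (A $ i * (A ^ n) $ (m - i)) =
      (c ^ Suc i * A $ i) * (c ^ (n + (m - i)) * (A ^ n) $ (m - i))"
      by (simp only: mult.assoc mult.left_commute)
  qed simp
  also have "\<dots> \<in> \<int>" by (intro Ints_sum Ints_mult assms Suc.IH)
  finally show ?case .
qed

lemma fps_mult_weighted_nth_le:
  fixes A B :: "'a :: real_normed_field fps"
  assumes r: "r > 0"
  shows "norm ((A * B) $ m) / r ^ m \<le>
    (\<Sum>i\<le>m. norm (A $ i) / r ^ i * (norm (B $ (m - i)) / r ^ (m - i)))"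
proof -
  have "norm ((A * B) $ m) / r ^ m \<le> (\<Sum>i\<le>m. norm (A $ i * B $ (m - i))) / r ^ m"
    using r by (intro divide_right_mono) (auto simp: fps_mult_nth atMost_atLeast0 intro: norm_sum)
  also have "\<dots> = (\<Sum>i\<le>m. norm (A $ i) / r ^ i * (norm (B $ (m - i)) / r ^ (m - i)))"
    unfolding sum_divide_distrib
    by (rule sum.cong) (auto simp: norm_mult simp flip: power_add)
  finally show ?thesis .
qed

text \<open>
  The norm that adds up the absolute values of the coefficients with weights \<open>1/r^m\<close> is
  submultiplicative; partial sums avoid all questions of convergence.
\<close>
lemma fps_power_weighted_sum_le:
  fixes A :: "'a :: real_normed_field fps"
  assumes r: "r > 0" and S: "\<And>M. (\<Sum>m\<le>M. norm (A $ m) / r ^ m) \<le> S"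
  shows "(\<Sum>m\<le>M. norm ((A ^ n) $ m) / r ^ m) \<le> S ^ n"
proof (induction n)
  case 0
  have "(\<Sum>m\<le>M. norm ((1 :: 'a fps) $ m) / r ^ m) = (\<Sum>m\<le>M. if m = 0 then 1 else 0)"
    by (rule sum.cong) auto
  thus ?case by simp
next
  case (Suc n)
  define u where "u F m = norm (F $ m) / r ^ m" for F :: "'a fps" and m
  have nonneg: "u F m \<ge> 0" for F m using r by (simp add: u_def)
  have "(\<Sum>m\<le>M. u (A ^ Suc n) m) \<le> (\<Sum>m\<le>M. \<Sum>i\<le>m. u A i * u (A ^ n) (m - i))"
    unfolding u_def power_Suc by (intro sum_mono fps_mult_weighted_nth_le r)
  also have "\<dots> = (\<Sum>(i,j) | i + j \<le> M. u A i * u (A ^ n) j)"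
    by (rule sum.triangle_reindex_eq[symmetric])
  also have "\<dots> \<le> (\<Sum>(i,j)\<in>{..M} \<times> {..M}. u A i * u (A ^ n) j)"
    by (rule sum_mono2) (auto intro!: mult_nonneg_nonneg nonneg)
  also have "\<dots> = (\<Sum>i\<le>M. u A i) * (\<Sum>j\<le>M. u (A ^ n) j)"
    by (simp add: sum_product sum.cartesian_product)
  also have "\<dots> \<le> S * S ^ n"
  proof (rule mult_mono)
    show le: "(\<Sum>i\<le>M. u A i) \<le> S" using S[of M] by (simp add: u_def)
    show "(\<Sum>j\<le>M. u (A ^ n) j) \<le> S ^ n" using Suc.IH by (simp add: u_def)
    show "0 \<le> S" using le sum_nonneg[of "{..M}" "u A"] nonneg by force
  qed (auto intro: sum_nonneg nonneg)
  finally show ?case by (simp add: u_def)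
qed

text \<open>
  Only \<open>n\<close> of the \<open>n + 1\<close> factors cost the sum bound \<open>S\<close>. The last one costs the pointwise bound
  \<open>C\<close>, which is much smaller in the application.
\<close>
lemma fps_power_Suc_nth_le:
  fixes A :: "'a :: real_normed_field fps"
  assumes r: "r > 0" and C: "\<And>m. norm (A $ m) / r ^ m \<le> C"
    and S: "\<And>M. (\<Sum>m\<le>M. norm (A $ m) / r ^ m) \<le> S"
  shows "norm ((A ^ Suc n) $ m) \<le> C * S ^ n * r ^ m"
proof -
  have "C \<ge> 0" using order_trans[OF _ C[of 0]] by simp
  have "norm ((A ^ Suc n) $ m) / r ^ m \<le>
      (\<Sum>i\<le>m. norm ((A ^ n) $ i) / r ^ i * (norm (A $ (m - i)) / r ^ (m - i)))"
    unfolding power_Suc2 by (rule fps_mult_weighted_nth_le[OF r])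
  also have "\<dots> \<le> (\<Sum>i\<le>m. norm ((A ^ n) $ i) / r ^ i * C)"
    using r by (intro sum_mono mult_left_mono C) auto
  also have "\<dots> \<le> S ^ n * C"
    unfolding sum_distrib_right[symmetric]
    using fps_power_weighted_sum_le[OF r S] \<open>C \<ge> 0\<close> by (intro mult_right_mono) auto
  finally show ?thesis using r by (simp add: field_simps)
qed

lemma sum_inverse_powers_of_two: "(\<Sum>i=1..k. 1 / 2 ^ i) = (1 - 1 / 2 ^ k :: real)"
  by (induction k) auto

section \<open>The inverse of the reversed polynomial\<close>

text \<open>
  If \<open>V\<close> is a partial sum of \<open>v\<close>, summing the recursion gives \<open>V \<le> C + (1 - 1/2^d) V\<close>, and
  \<open>V\<close> can be solved for because the weights add up to less than \<open>1\<close>.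
\<close>
lemma geometric_recursion_bounds:
  fixes v :: "nat \<Rightarrow> real"
  assumes nonneg: "\<And>m. v m \<ge> 0"
    and rec: "\<And>m. v m \<le> (if m = 0 then C else 0) + (\<Sum>i=1..min d m. v (m - i) / 2 ^ i)"
  shows "v m \<le> C" and "(\<Sum>m\<le>M. v m) \<le> 2 ^ d * C"
proof -
  have C: "C \<ge> 0" using nonneg[of 0] rec[of 0] by simp
  show "v m \<le> C"
  proof (induction m rule: less_induct)
    case (less m)
    show ?case
    proof (cases "m = 0")
      case False
      have "v m \<le> (\<Sum>i=1..min d m. v (m - i) / 2 ^ i)" using rec[of m] False by simp
      also have "\<dots> \<le> (\<Sum>i=1..min d m. C * (1 / 2 ^ i))"
        by (rule sum_mono) (use less.IH False in \<open>auto intro!: divide_right_mono\<close>)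
      also have "\<dots> = C * (1 - 1 / 2 ^ min d m)"
        by (simp only: sum_distrib_left[symmetric] sum_inverse_powers_of_two)
      also have "\<dots> \<le> C" using C by (simp add: algebra_simps)
      finally show ?thesis .
    qed (use rec[of 0] in simp)
  qed
  define V where "V = (\<Sum>m\<le>M. v m)"
  have "V \<le> (\<Sum>m\<le>M. (if m = 0 then C else 0) + (\<Sum>i=1..min d m. v (m - i) / 2 ^ i))"
    unfolding V_def by (intro sum_mono rec)
  also have "\<dots> = C + (\<Sum>m\<le>M. \<Sum>i=1..min d m. v (m - i) / 2 ^ i)"
    by (simp add: sum.distrib)
  also have "(\<Sum>m\<le>M. \<Sum>i=1..min d m. v (m - i) / 2 ^ i) =
             (\<Sum>m\<le>M. \<Sum>i | i \<in> {1..d} \<and> i \<le> m. v (m - i) / 2 ^ i)"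
    by (intro sum.cong) auto
  also have "\<dots> = (\<Sum>i=1..d. \<Sum>m | m \<in> {..M} \<and> i \<le> m. v (m - i) / 2 ^ i)"
    by (rule sum.swap_restrict) auto
  also have "\<dots> \<le> (\<Sum>i=1..d. V * (1 / 2 ^ i))"
  proof (rule sum_mono)
    fix i
    have "(\<Sum>m | m \<in> {..M} \<and> i \<le> m. v (m - i)) \<le> V"
      unfolding V_def using nonneg
      by (intro sum_le_included[of _ _ _ "\<lambda>k. k + i"]) force+
    thus "(\<Sum>m | m \<in> {..M} \<and> i \<le> m. v (m - i) / 2 ^ i) \<le> V * (1 / 2 ^ i)"
      by (simp add: sum_divide_distrib[symmetric] divide_right_mono)
  qed
  also have "\<dots> = V - V / 2 ^ d"
    by (simp only: sum_distrib_left[symmetric] sum_inverse_powers_of_two) (simp add: algebra_simps)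
  finally show "V \<le> 2 ^ d * C" by (simp add: field_simps)
qed

definition max_abs_coeff :: "int poly \<Rightarrow> int" where
  "max_abs_coeff f = Max ((\<lambda>i. \<bar>coeff f i\<bar>) ` {..degree f})"

lemma abs_coeff_le_max: "\<bar>coeff f i\<bar> \<le> max_abs_coeff f"
proof (cases "i \<le> degree f")
  case True
  thus ?thesis by (auto simp: max_abs_coeff_def)
next
  case False
  have "\<bar>coeff f 0\<bar> \<le> max_abs_coeff f" by (auto simp: max_abs_coeff_def)
  thus ?thesis using False by (simp add: coeff_eq_0 not_le)
qed

definition reversed_inverse :: "int poly \<Rightarrow> complex fps" where
  "reversed_inverse f = inverse (fps_of_poly (reflect_poly (map_poly of_int f)))"

lemma degree_of_int_poly [simp]:
  "degree (map_poly of_int f :: complex poly) = degree f"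
  by (rule degree_map_poly) auto

text \<open>Compare the coefficients of \<open>y^m\<close> in \<open>F * (1/F) = 1\<close>, where \<open>F\<close> is the reversed \<open>f\<close>.\<close>
lemma reversed_inverse_recursion:
  assumes f: "f \<noteq> 0"
  defines "A \<equiv> reversed_inverse f"
  shows "of_int (lead_coeff f) * A $ m = (if m = 0 then 1 else 0) -
    (\<Sum>i=1..min (degree f) m. of_int (coeff f (degree f - i)) * A $ (m - i))"
proof -
  define T :: "complex fps" where "T = fps_of_poly (reflect_poly (map_poly of_int f))"
  have T_nth: "T $ i = (if i > degree f then 0 else of_int (coeff f (degree f - i)))" for i
    by (simp add: T_def coeff_reflect_poly coeff_map_poly)
  have "T $ 0 \<noteq> 0" using f by (simp add: T_nth)
  hence "T * A = 1" by (simp add: A_def reversed_inverse_def T_def inverse_mult_eq_1')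
  hence "(\<Sum>i=0..m. T $ i * A $ (m - i)) = (if m = 0 then 1 else 0)"
    by (metis fps_mult_nth fps_one_nth)
  also have "(\<Sum>i=0..m. T $ i * A $ (m - i)) = T $ 0 * A $ m + (\<Sum>i=1..m. T $ i * A $ (m - i))"
    by (simp add: sum.atLeast_Suc_atMost)
  also have "(\<Sum>i=1..m. T $ i * A $ (m - i)) =
      (\<Sum>i=1..min (degree f) m. of_int (coeff f (degree f - i)) * A $ (m - i))"
    by (rule sum.mono_neutral_cong_right) (auto simp: T_nth)
  finally show ?thesis by (simp add: T_nth eq_diff_eq)
qed

lemma reversed_inverse_scaled_Ints:
  assumes f: "f \<noteq> 0"
  shows "of_int (lead_coeff f) ^ Suc m * reversed_inverse f $ m \<in> \<int>"
proof (induction m rule: less_induct)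
  case (less m)
  define c :: complex where "c = of_int (lead_coeff f)"
  define A where "A = reversed_inverse f"
  have "c ^ Suc m * A $ m = c ^ m * (c * A $ m)" by simp
  also have "\<dots> = c ^ m * ((if m = 0 then 1 else 0) -
      (\<Sum>i=1..min (degree f) m. of_int (coeff f (degree f - i)) * A $ (m - i)))"
    unfolding c_def A_def by (subst reversed_inverse_recursion[OF f]) (rule refl)
  also have "\<dots> = c ^ m * (if m = 0 then 1 else 0) - (\<Sum>i=1..min (degree f) m.
      of_int (coeff f (degree f - i)) * c ^ (i - 1) * (c ^ Suc (m - i) * A $ (m - i)))"
    unfolding right_diff_distrib sum_distrib_left
  proof (intro arg_cong2[where f = "(-)"] sum.cong refl)
    fix i assume "i \<in> {1..min (degree f) m}"
    \<comment> \<open>As \<open>i\<close> is at least \<open>1\<close>, the power \<open>c ^ m\<close> contains the power that clears \<open>A $ (m - i)\<close>.\<close>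
    hence "m = (i - 1) + Suc (m - i)" by auto
    hence "c ^ m = c ^ (i - 1) * c ^ Suc (m - i)" by (metis power_add)
    thus "c ^ m * (of_int (coeff f (degree f - i)) * A $ (m - i)) =
      of_int (coeff f (degree f - i)) * c ^ (i - 1) * (c ^ Suc (m - i) * A $ (m - i))"
      by (simp only: mult.assoc mult.left_commute)
  qed
  also have "\<dots> \<in> \<int>"
    unfolding c_def A_def
    by (intro Ints_diff Ints_mult[OF Ints_mult[OF Ints_of_int Ints_power[OF Ints_of_int]]]
          Ints_mult[OF Ints_power[OF Ints_of_int]] Ints_sum less.IH) auto
  finally show ?case by (simp add: c_def A_def)
qed

text \<open>
  The radius \<open>r = 2H/L\<close> is chosen such that the coefficient \<open>f_(d-i)\<close> of the recursion, divided by
  \<open>L r^i\<close>, is at most \<open>(H/L) / r^i = (L/H)^(i-1) / 2^i \<le> 1/2^i\<close>.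
\<close>
lemma reversed_inverse_weighted_bounds:
  assumes f: "f \<noteq> 0"
  defines "L \<equiv> real_of_int \<bar>lead_coeff f\<bar>"
  defines "r \<equiv> 2 * real_of_int (max_abs_coeff f) / L"
  shows "norm (reversed_inverse f $ m) / r ^ m \<le> 1 / L"
    and "(\<Sum>m\<le>M. norm (reversed_inverse f $ m) / r ^ m) \<le> 2 ^ degree f * (1 / L)"
proof -
  define H where "H = real_of_int (max_abs_coeff f)"
  define A where "A = reversed_inverse f"
  define v where "v m = norm (A $ m) / r ^ m" for m
  have L: "L > 0" using f by (simp add: L_def)
  have LH: "L \<le> H" unfolding L_def H_def using abs_coeff_le_max by (simp only: of_int_le_iff)
  have r: "r > 0" using L LH by (simp add: r_def H_def)
  have r2: "H / L / r ^ i \<le> 1 / 2 ^ i" if "i \<ge> 1" for i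
  proof -
    have "H / L / r ^ i = 1 / 2 ^ i * (L / H) ^ (i - 1)"
      using that L LH by (cases i) (auto simp: r_def H_def field_simps)
    also have "\<dots> \<le> 1 / 2 ^ i * 1"
      using L LH by (intro mult_left_mono power_le_one) auto
    finally show ?thesis by simp
  qed
  have rec: "v m \<le> (if m = 0 then 1 / L else 0) + (\<Sum>i=1..min (degree f) m. v (m - i) / 2 ^ i)" for m
  proof -
    have "L * norm (A $ m) = norm (of_int (lead_coeff f) * A $ m)"
      by (simp add: L_def norm_mult)
    also have "\<dots> \<le> norm (if m = 0 then 1 else 0 :: complex) +
        norm (\<Sum>i=1..min (degree f) m. of_int (coeff f (degree f - i)) * A $ (m - i))"
      unfolding A_def reversed_inverse_recursion[OF f] by (rule norm_triangle_ineq4)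
    also have "\<dots> \<le> (if m = 0 then 1 else 0) + (\<Sum>i=1..min (degree f) m. H * norm (A $ (m - i)))"
    proof (rule add_mono)
      show "norm (\<Sum>i=1..min (degree f) m. of_int (coeff f (degree f - i)) * A $ (m - i)) \<le>
        (\<Sum>i=1..min (degree f) m. H * norm (A $ (m - i)))"
        using abs_coeff_le_max[of f]
        by (intro order_trans[OF norm_sum] sum_mono)
           (auto simp: norm_mult H_def intro!: mult_right_mono simp flip: of_int_abs)
    qed auto
    finally have "norm (A $ m) \<le>
        ((if m = 0 then 1 else 0) + (\<Sum>i=1..min (degree f) m. H * norm (A $ (m - i)))) / L"
      using L by (simp add: field_simps)
    hence "v m \<le>
        ((if m = 0 then 1 else 0) + (\<Sum>i=1..min (degree f) m. H * norm (A $ (m - i)))) / L / r ^ m"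
      unfolding v_def using r by (intro divide_right_mono) auto
    also have "\<dots> = (if m = 0 then 1 / L else 0) +
        (\<Sum>i=1..min (degree f) m. H / L / r ^ i * v (m - i))"
    proof -
      have "H * norm (A $ (m - i)) / L / r ^ m = H / L / r ^ i * v (m - i)" if "i \<le> m" for i
        using that r L power_add[of r i "m - i"] by (simp add: v_def)
      hence "(\<Sum>i=1..min (degree f) m. H * norm (A $ (m - i)) / L / r ^ m) =
        (\<Sum>i=1..min (degree f) m. H / L / r ^ i * v (m - i))" by (intro sum.cong) auto
      thus ?thesis by (simp add: add_divide_distrib sum_divide_distrib)
    qed
    also have "\<dots> \<le> (if m = 0 then 1 / L else 0) + (\<Sum>i=1..min (degree f) m. 1 / 2 ^ i * v (m - i))"
      using r by (intro add_left_mono sum_mono mult_right_mono r2) (auto simp: v_def)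
    finally show ?thesis by simp
  qed
  have nonneg: "v m \<ge> 0" for m using r by (simp add: v_def)
  show "norm (reversed_inverse f $ m) / r ^ m \<le> 1 / L"
    and "(\<Sum>m\<le>M. norm (reversed_inverse f $ m) / r ^ m) \<le> 2 ^ degree f * (1 / L)"
    using geometric_recursion_bounds[of v, OF nonneg rec] by (simp_all add: v_def A_def)
qed

section \<open>Integrality and size of the global residue\<close>

lemma global_residue_eq_sum:
  assumes deg: "degree f > 0"
  shows "global_residue g f (Suc n) = (\<Sum>j\<le>degree g. of_int (coeff g j) *
    (if Suc j < Suc n * degree f then 0
     else (reversed_inverse f ^ Suc n) $ (Suc j - Suc n * degree f)))"
proof -
  define F G :: "complex poly" where "F = map_poly of_int f" and "G = map_poly of_int g"
  define Q where "Q = F ^ Suc n"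
  have F: "F \<noteq> 0" using deg by (auto simp: F_def map_poly_eq_0_iff)
  hence Q: "Q \<noteq> 0" by (simp add: Q_def)
  have degQ: "degree Q = Suc n * degree f"
    unfolding Q_def by (subst degree_power_eq[OF F]) (simp add: F_def)
  have "global_residue g f (Suc n) = residue_sum Q G"
    unfolding global_residue_def residue_sum_def
    by (simp add: Q_def F_def G_def poly_power del: power_Suc)
  also have "G = (\<Sum>j\<le>degree g. smult (coeff G j) (monom 1 j))"
    using poly_as_sum_of_monoms[of G] by (simp add: smult_monom G_def)
  also have "residue_sum Q \<dots> = (\<Sum>j\<le>degree g. of_int (coeff g j) * residue_sum Q (monom 1 j))"
    by (simp add: residue_sum_sum[OF Q] residue_sum_smult[OF Q] G_def coeff_map_poly)
  finally have sum: "global_residue g f (Suc n) =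
    (\<Sum>j\<le>degree g. of_int (coeff g j) * residue_sum Q (monom 1 j))" .
  have "inverse (fps_of_poly (reflect_poly Q)) = reversed_inverse f ^ Suc n"
    by (simp only: Q_def reflect_poly_power fps_of_poly_power fps_inverse_power
          reversed_inverse_def F_def)
  hence "residue_sum Q (monom 1 j) = (if Suc j < Suc n * degree f then 0
      else (reversed_inverse f ^ Suc n) $ (Suc j - Suc n * degree f))" for j
    using deg by (subst residue_sum_monom_eq_fps_nth) (simp_all only: degQ, simp_all)
  thus ?thesis unfolding sum by simp
qed

theorem theorem1p2:
  fixes f g :: "int poly" and d e \<alpha> :: nat
  assumes "degree f > 0" and "g \<noteq> 0"
    and "d = degree f" and "e = degree g"
  shows "of_int (lead_coeff f) powi (int e + 1 - (int \<alpha> + 1) * (int d - 1))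
            * global_residue g f (\<alpha> + 1) \<in> (\<int> :: complex set) \<and>
         elog (cmod (of_int (lead_coeff f) powi (int e + 1 - (int \<alpha> + 1) * (int d - 1))
            * global_residue g f (\<alpha> + 1)))
         \<le> ereal (poly_length g
              + (real e + 1 - (real \<alpha> + 1) * real d) * poly_height f
              + (real e - real d + 1) * ln 2) \<and>
         (int e < (int \<alpha> + 1) * int d - 1 \<longrightarrow> global_residue g f (\<alpha> + 1) = 0)"
proof -
  define n where "n = Suc \<alpha>"
  define c :: complex where "c = of_int (lead_coeff f)"
  define L where "L = real_of_int \<bar>lead_coeff f\<bar>"
  define H where "H = real_of_int (max_abs_coeff f)"
  define A where "A = reversed_inverse f"
  have f: "f \<noteq> 0" using assms by auto
  have "1 \<le> \<bar>lead_coeff f\<bar>" using f by (simp add: int_one_le_iff_zero_less)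
  hence L: "L \<ge> 1" unfolding L_def by (simp only: of_int_1_le_iff)
  have LH: "L \<le> H" unfolding L_def H_def using abs_coeff_le_max by (simp only: of_int_le_iff)
  have norm_c: "norm c = L" by (simp add: c_def L_def)
  have res: "global_residue g f (\<alpha> + 1) = (\<Sum>j\<le>e. of_int (coeff g j) *
      (if Suc j < n * d then 0 else (A ^ n) $ (Suc j - n * d)))"
    using global_residue_eq_sum[OF assms(1), of g \<alpha>]
    by (simp only: n_def A_def assms(3,4) Suc_eq_plus1)
  show ?thesis
  proof (cases "Suc e < n * d")
    case True
    have "global_residue g f (\<alpha> + 1) = 0"
      unfolding res by (rule sum.neutral) (use True in auto)
    thus ?thesis by (simp add: elog_def)
  next
    case False
    define k where "k = Suc e - n * d"
    have k: "Suc e = n * d + k" using False by (simp add: k_def)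
    have ek: "int e + 1 - (int \<alpha> + 1) * (int d - 1) = int (n + k)"
      using arg_cong[OF k, of int] by (simp add: n_def algebra_simps)
    \<comment> \<open>\<open>Y j\<close> is the normalised residue for the numerator \<open>x^j\<close>. Its series coefficient has index
        \<open>k - (e - j)\<close>, so \<open>c ^ (n + k)\<close> exceeds what is needed to clear it by \<open>c ^ (e - j)\<close>.\<close>
    define Y where "Y = (\<lambda>j. if Suc j < n * d then 0
      else c ^ (n + k) * (A ^ n) $ (Suc j - n * d))"
    have lhs: "c powi (int e + 1 - (int \<alpha> + 1) * (int d - 1)) * global_residue g f (\<alpha> + 1) =
      (\<Sum>j\<le>e. of_int (coeff g j) * Y j)"
      unfolding ek power_int_of_nat res sum_distrib_left
      by (rule sum.cong) (auto simp: Y_def)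
    have split: "k = (e - j) + (Suc j - n * d)" if "j \<le> e" "\<not> Suc j < n * d" for j
      using that k by simp
    have int: "Y j \<in> \<int>" if "j \<le> e" for j
    proof (cases "Suc j < n * d")
      case False
      define m where "m = Suc j - n * d"
      have "n + k = (e - j) + (n + m)" using split[OF that False] by (simp add: m_def)
      hence "c ^ (n + k) = c ^ (e - j) * c ^ (n + m)" by (metis power_add)
      hence "Y j = c ^ (e - j) * (c ^ (n + m) * (A ^ n) $ m)"
        using False by (simp add: Y_def m_def)
      also have "\<dots> \<in> \<int>"
        unfolding c_def A_def
        by (intro Ints_mult Ints_power fps_power_nth_scaled_Ints reversed_inverse_scaled_Ints f) auto
      finally show ?thesis .
    qed (simp add: Y_def)
    have bound: "norm (Y j) \<le> 2 ^ (\<alpha> * d + k) * H ^ k" if "j \<le> e" for j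
    proof (cases "Suc j < n * d")
      case False
      define m where "m = Suc j - n * d"
      have km: "k = (e - j) + m" using split[OF that False] by (simp add: m_def)
      have r: "2 * H / L > 0" using L LH by simp
      have "norm (Y j) = L ^ (n + k) * norm ((A ^ Suc \<alpha>) $ m)"
        using False by (simp add: Y_def norm_mult norm_power norm_c m_def n_def)
      also have "\<dots> \<le> L ^ (n + k) * (1 / L * (2 ^ d * (1 / L)) ^ \<alpha> * (2 * H / L) ^ m)"
        using reversed_inverse_weighted_bounds[OF f] r L assms
        by (intro mult_left_mono fps_power_Suc_nth_le) (auto simp: A_def H_def L_def)
      also have "\<dots> = 2 ^ (\<alpha> * d) * (L ^ (e - j) * (2 * H) ^ m)"
        using L by (simp add: km n_def power_add power_mult_distrib power_divide
            power_mult[symmetric] mult.commute)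
      \<comment> \<open>Trading \<open>L\<close> for \<open>2 * H\<close> makes the bound independent of \<open>j\<close>.\<close>
      also have "\<dots> \<le> 2 ^ (\<alpha> * d) * ((2 * H) ^ (e - j) * (2 * H) ^ m)"
        using L LH by (intro mult_left_mono mult_right_mono power_mono) auto
      also have "\<dots> = 2 ^ (\<alpha> * d + k) * H ^ k"
        by (simp add: km power_add power_mult_distrib)
      finally show ?thesis .
    qed (use L LH in \<open>simp add: Y_def\<close>)
    define W where "W = (\<Sum>j\<le>e. of_int (coeff g j) * Y j)"
    define G where "G = real_of_int (\<Sum>j\<le>e. \<bar>coeff g j\<bar>)"
    have "W \<in> \<int>" unfolding W_def by (intro Ints_sum Ints_mult int) auto
    have "norm W \<le> (\<Sum>j\<le>e. \<bar>coeff g j\<bar> * (2 ^ (\<alpha> * d + k) * H ^ k))"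
      unfolding W_def
      by (intro order_trans[OF norm_sum] sum_mono)
         (auto simp: norm_mult intro!: mult_left_mono bound)
    hence norm_W: "norm W \<le> G * (2 ^ (\<alpha> * d + k) * H ^ k)"
      by (simp add: G_def sum_distrib_right)
    have "G > 0"
    proof -
      have "0 < \<bar>coeff g e\<bar>" using assms by simp
      also have "\<dots> \<le> (\<Sum>j\<le>e. \<bar>coeff g j\<bar>)" by (intro member_le_sum) auto
      finally show ?thesis unfolding G_def by (simp only: of_int_0_less_iff)
    qed
    have "elog (norm W) \<le> ereal (ln G + (real \<alpha> * real d + real k) * ln 2 + real k * ln H)"
    proof (cases "W = 0")
      case False
      hence "ln (norm W) \<le> ln (G * (2 ^ (\<alpha> * d + k) * H ^ k))"
        using norm_W by (intro ln_mono) auto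
      also have "\<dots> = ln G + (real \<alpha> * real d + real k) * ln 2 + real k * ln H"
        using \<open>G > 0\<close> L LH by (simp add: ln_mult ln_realpow)
      finally show ?thesis using False by (simp add: elog_def)
    qed (simp add: elog_def)
    moreover have "real k = real e + 1 - (real \<alpha> + 1) * real d"
      using arg_cong[OF k, of real] by (simp add: n_def algebra_simps)
    moreover from this have "real \<alpha> * real d + real k = real e - real d + 1"
      by (simp add: algebra_simps)
    moreover have "ln G = poly_length g" "ln H = poly_height f"
      by (simp_all add: G_def H_def poly_length_def poly_height_def max_abs_coeff_def assms)
    moreover have "\<not> int e < (int \<alpha> + 1) * int d - 1"
      using arg_cong[OF k, of int] by (simp add: n_def algebra_simps)
    ultimately show ?thesis
      using \<open>W \<in> \<int>\<close> lhs unfolding W_def c_def by (simp add: algebra_simps)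
  qed
qed

end
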